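(* For every integer $d\ge 1$ there exists a faithful $1$-weak combinatorial description of $\mathcal{W}_d$ compatible with $\mathrm{MI}_{\mathfrak{S}}$. Concretely: there exist sets $\mathrm{CD}_d(n)$ ($n\ge1$, with trivial $\mathfrak{S}_n$-action), maps $H^n_d:\mathrm{CD}_d(n)\to\mathcal{W}^n_d$ such that $H^n_d(\mathrm{CD}_d(n))$ is a basis of $\mathcal{W}^n_d$, and surjections $q_n:\mathrm{CD}_d(n)\to\mathrm{MI}(n)/\mathfrak{S}_n$ such that $\pi_d(H^n_d(a))=G^n(q_n(a))$ for all $a\in\mathrm{CD}_d(n)$.
   Context: Rooted trees: a rooted tree on $[n]$ is a set $E$ of ordered pairs (an edge $(v,w)$ means $w$ is a child of $v$) such that exactly one vertex (the root) has no parent, every other vertex has exactly one parent, and all vertices are connected to the root by following parents; $\mathrm{RT}(n)$ is the set of these. $\mathcal{C}_d=C^\infty(\mathbb{R}^d,\mathbb{R}^d)$. For $\tau$ with root $r$ whose children are $v_1,\dots,v_k$, recursively $F(\tau)((f^i)_{i})=\sum_{j_1,\dots,j_k=1}^d F(\tau_{v_1})(\cdots)_{j_1}\cdots F(\tau_{v_k})(\cdots)_{j_k}\,\partial_{j_1}\cdots\partial_{j_k}f^r$, with $\tau_{v_m}$ the subtree of $v_m$ and its descendants evaluated on the $f^i$ indexed by its vertices, $(\cdot)_j$ the $j$-th coordinate, $\partial_j=\partial/\partial x_j$ (single vertex: $F(\tau)=f^r$). With a single label ($\ell=1$), the labelled objects of arity $n$ of a sequence $C$ of $\mathfrak{S}_n$-sets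 are $C(n)/\mathfrak{S}_n$, and identification maps are trivial. $\mathcal{W}^n_d$ is the real span of the maps $\mathcal{C}_d\to\mathcal{C}_d$, $f\mapsto F(\tau)(f,\dots,f)$, $\tau\in\mathrm{RT}(n)$. $\mathrm{MI}(n)$ is the set of maps $\varphi:[n]\to\mathbb{N}$ with $\sum_v\varphi(v)=n-1$, $\mathfrak{S}_n$ permuting $[n]$; $\mathrm{MI}_{\mathfrak{S}}(n)=\mathrm{MI}(n)/\mathfrak{S}_n$. For $[\varphi]\in\mathrm{MI}_{\mathfrak{S}}(n)$ and $g\in C^\infty(\mathbb{R},\mathbb{R})$, $G^n([\varphi])(g)=g^{(\varphi(1))}\cdots g^{(\varphi(n))}$. The projection $\pi_d$ sends $\Phi:\mathcal{C}_d\to\mathcal{C}_d$ to $g\mapsto\big(t\mapsto$ first coordinate of $\Phi(\hat g)(t,0,\dots,0)\big)$, where $\hat g(x)=(g(x_1),0,\dots,0)$. A faithful $1$-weak combinatorial description of $\mathcal{W}_d$ is a sequence of $\mathfrak{S}_n$-sets $\mathrm{CD}_d(n)$ with maps $H^n_d:\mathrm{CD}_d(n)/\mathfrak{S}_n\to\mathcal{W}^n_d$ whose image is a basis of $\mathcal{W}^n_d$ for each $n$; compatibility with $\mathrm{MI}_{\mathfrak{S}}$ means surjections $q_n$ onto $\mathrm{MI}_{\mathfrak{S}}(n)$ with $\pi_d\circ H^n_d=G^n\circ q_n$. *)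

theory Defs
  imports "HOL-Analysis.Analysis" "HOL-Combinatorics.Permutations"
begin

section \<open>Smooth functions on R^d (index type 'd, d = CARD('d))\<close>

text \<open>Partial derivative of a real-valued function in coordinate direction j.\<close>
definition partial :: "'d::finite \<Rightarrow> (real^'d \<Rightarrow> real) \<Rightarrow> real^'d \<Rightarrow> real" where
  "partial j g x = deriv (\<lambda>t. g (x + t *\<^sub>R axis j 1)) 0"

text \<open>Iterated partial derivative: rpartials [j1,...,jk] g = d_j1 ... d_jk g.\<close>
fun rpartials :: "'d::finite list \<Rightarrow> (real^'d \<Rightarrow> real) \<Rightarrow> real^'d \<Rightarrow> real" where
  "rpartials [] g = g"
| "rpartials (j # js) g = partial j (rpartials js g)"

text \<open>C^infinity: all iterated partial derivatives exist and are continuous.\<close>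
definition smooth_real :: "(real^'d::finite \<Rightarrow> real) \<Rightarrow> bool" where
  "smooth_real g \<longleftrightarrow> (\<forall>js. continuous_on UNIV (rpartials js g) \<and>
       (\<forall>j x. (\<lambda>t. rpartials js g (x + t *\<^sub>R axis j 1)) differentiable (at 0)))"

text \<open>The space C_d = C^infinity(R^d, R^d).\<close>
definition smooth_vec :: "(real^'d::finite \<Rightarrow> real^'d) \<Rightarrow> bool" where
  "smooth_vec F \<longleftrightarrow> (\<forall>i. smooth_real (\<lambda>x. F x $ i))"

text \<open>Iterated partial derivative of a vector-valued function (componentwise).\<close>
definition dpartials :: "'d::finite list \<Rightarrow> (real^'d \<Rightarrow> real^'d) \<Rightarrow> real^'d \<Rightarrow> real^'d" where
  "dpartials js F x = (\<chi> i. rpartials js (\<lambda>y. F y $ i) x)"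

text \<open>C^infinity(R,R).\<close>
definition smooth1 :: "(real \<Rightarrow> real) \<Rightarrow> bool" where
  "smooth1 g \<longleftrightarrow> (\<forall>k x. ((deriv ^^ k) g) differentiable (at x))"

section \<open>Rooted trees on [n] = {1..n}\<close>

definition RT :: "nat \<Rightarrow> (nat \<times> nat) set set" where
  "RT n = {E. E \<subseteq> {1..n} \<times> {1..n}
      \<and> (\<exists>!r. r \<in> {1..n} \<and> (\<forall>v. (v, r) \<notin> E))
      \<and> (\<forall>w\<in>{1..n}. (\<exists>v. (v, w) \<in> E) \<longrightarrow> (\<exists>!v. (v, w) \<in> E))
      \<and> (\<forall>r\<in>{1..n}. (\<forall>v. (v, r) \<notin> E) \<longrightarrow> (\<forall>w\<in>{1..n}. (r, w) \<in> E\<^sup>*))}"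

definition tree_root :: "nat \<Rightarrow> (nat \<times> nat) set \<Rightarrow> nat" where
  "tree_root n E = (THE r. r \<in> {1..n} \<and> (\<forall>v. (v, r) \<notin> E))"

definition children :: "(nat \<times> nat) set \<Rightarrow> nat \<Rightarrow> nat set" where
  "children E v = {w. (v, w) \<in> E}"

text \<open>Elementary differential of the subtree at vertex v, with recursion fuel k
  (fuel n suffices for a tree on n vertices; a leaf gives fs v).\<close>
fun elem_diff_at :: "nat \<Rightarrow> (nat \<times> nat) set \<Rightarrow> (nat \<Rightarrow> real^'d::finite \<Rightarrow> real^'d)
    \<Rightarrow> nat \<Rightarrow> real^'d \<Rightarrow> real^'d" where
  "elem_diff_at 0 E fs v = fs v"
| "elem_diff_at (Suc k) E fs v = (\<lambda>x.
     \<Sum>J \<in> children E v \<rightarrow>\<^sub>E (UNIV :: 'd set).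
        (\<Prod>w\<in>children E v. elem_diff_at k E fs w x $ J w)
          *\<^sub>R dpartials (map J (sorted_list_of_set (children E v))) (fs v) x)"

text \<open>F(tau)((f^i)_i) for tau = E in RT(n).\<close>
definition elem_diff :: "nat \<Rightarrow> (nat \<times> nat) set \<Rightarrow> (nat \<Rightarrow> real^'d::finite \<Rightarrow> real^'d)
    \<Rightarrow> real^'d \<Rightarrow> real^'d" where
  "elem_diff n E fs = elem_diff_at n E fs (tree_root n E)"

section \<open>The space W^n_d of maps C_d -> C_d (maps compared on C_d only)\<close>

type_synonym 'd cmap = "(real^'d \<Rightarrow> real^'d) \<Rightarrow> (real^'d \<Rightarrow> real^'d)"

definition W :: "nat \<Rightarrow> ('d::finite) cmap set" where
  "W n = {M. \<exists>c :: (nat \<times> nat) set \<Rightarrow> real. \<forall>f. smooth_vec f \<longrightarrow>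
            M f = (\<lambda>x. \<Sum>\<tau>\<in>RT n. c \<tau> *\<^sub>R elem_diff n \<tau> (\<lambda>_. f) x)}"

definition lin_comb :: "('d::finite) cmap set \<Rightarrow> ('d cmap \<Rightarrow> real) \<Rightarrow> 'd cmap" where
  "lin_comb S a = (\<lambda>f x. \<Sum>M\<in>S. a M *\<^sub>R M f x)"

text \<open>Linear independence / span in the real vector space of maps C_d -> C_d.\<close>
definition lin_indep_maps :: "('d::finite) cmap set \<Rightarrow> bool" where
  "lin_indep_maps B \<longleftrightarrow> (\<forall>S a. finite S \<and> S \<subseteq> B \<and>
       (\<forall>f. smooth_vec f \<longrightarrow> lin_comb S a f = (\<lambda>x. 0)) \<longrightarrow> (\<forall>M\<in>S. a M = 0))"

definition in_span_maps :: "('d::finite) cmap set \<Rightarrow> 'd cmap \<Rightarrow> bool" where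
  "in_span_maps B M \<longleftrightarrow> (\<exists>S a. finite S \<and> S \<subseteq> B \<and>
       (\<forall>f. smooth_vec f \<longrightarrow> M f = lin_comb S a f))"

definition is_basis_of_W :: "nat \<Rightarrow> ('d::finite) cmap set \<Rightarrow> bool" where
  "is_basis_of_W n B \<longleftrightarrow> B \<subseteq> W n \<and> lin_indep_maps B \<and> (\<forall>M\<in>W n. in_span_maps B M)"

section \<open>MI(n), its S_n-orbits, G^n and the projection pi_d\<close>

definition MI :: "nat \<Rightarrow> (nat \<Rightarrow> nat) set" where
  "MI n = {\<phi> \<in> {1..n} \<rightarrow>\<^sub>E (UNIV :: nat set). (\<Sum>v\<in>{1..n}. \<phi> v) = n - 1}"

definition MI_rel :: "nat \<Rightarrow> ((nat \<Rightarrow> nat) \<times> (nat \<Rightarrow> nat)) set" where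
  "MI_rel n = {(\<phi>, \<psi>). \<phi> \<in> MI n \<and> \<psi> \<in> MI n \<and> (\<exists>\<sigma>. \<sigma> permutes {1..n} \<and> \<psi> = \<phi> \<circ> \<sigma>)}"

text \<open>MI_S(n) = MI(n)/S_n, the set of orbits.\<close>
definition MIS :: "nat \<Rightarrow> (nat \<Rightarrow> nat) set set" where
  "MIS n = MI n // MI_rel n"

definition G :: "nat \<Rightarrow> (nat \<Rightarrow> nat) set \<Rightarrow> (real \<Rightarrow> real) \<Rightarrow> real \<Rightarrow> real" where
  "G n c g = (let \<phi> = (SOME \<phi>. \<phi> \<in> c) in (\<lambda>t. \<Prod>v\<in>{1..n}. (deriv ^^ \<phi> v) g t))"

text \<open>The first coordinate index.\<close>
definition e1 :: "'d::{finite,wellorder}" where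
  "e1 = (LEAST i. True)"

definition proj :: "('d::{finite,wellorder}) cmap \<Rightarrow> (real \<Rightarrow> real) \<Rightarrow> real \<Rightarrow> real" where
  "proj \<Phi> g = (\<lambda>t. \<Phi> (\<lambda>x. \<chi> i. if i = e1 then g (x $ e1) else 0)
                      (\<chi> i. if i = e1 then t else 0) $ e1)"

end

theory Submission
  imports Defs
begin

text \<open>
  The maps \<open>f \<mapsto> F(\<tau>)(f,\<dots>,f)\<close> span \<open>W n\<close>, so finitely many of them form a basis. The projection sends
  such a map to \<open>G n\<close> of the class of the fertility function of \<open>\<tau>\<close>, which defines \<open>q n\<close>. Every class is
  the fertility class of some tree, whose map is a combination of the basis; projecting this relation
  and using that the monomials \<open>G n c\<close> are linearly independent shows that \<open>q n\<close> is onto.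
\<close>

section \<open>Finite families of maps\<close>

lemma in_span_maps_mono:
  "in_span_maps B M \<Longrightarrow> B \<subseteq> C \<Longrightarrow> in_span_maps C M"
  unfolding in_span_maps_def by blast

lemma in_span_maps_base: "M \<in> B \<Longrightarrow> in_span_maps B M"
  unfolding in_span_maps_def
  by (rule exI[of _ "{M}"], rule exI[of _ "\<lambda>_. 1"]) (auto simp: lin_comb_def)

text \<open>Padding with zero coefficients turns a combination over some finite subset into one over
  all of \<open>B\<close>, so that expansions of different maps can be added
  coefficientwise.\<close>

lemma in_span_maps_finiteE:
  assumes "in_span_maps B M" "finite B"
  obtains a where "\<And>f. smooth_vec f \<Longrightarrow> M f = lin_comb B a f"
proof -
  obtain S a where S: "finite S" "S \<subseteq> B" "\<And>f. smooth_vec f \<Longrightarrow> M f = lin_comb S a f"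
    using assms(1) unfolding in_span_maps_def by blast
  have "lin_comb S a = lin_comb B (\<lambda>N. if N \<in> S then a N else 0)"
    unfolding lin_comb_def using S assms(2)
    by (intro ext sum.mono_neutral_cong_left) auto
  with S(3) show ?thesis by (intro that) simp
qed

text \<open>A relation with a nonzero coefficient at \<open>M\<close> could be solved for
  \<open>M\<close>, which would put \<open>M\<close> into the span of \<open>B\<close>. With that
  coefficient zero, the relation lives in \<open>B\<close>. Maps are compared on smooth inputs only,
  so the argument works directly with \<open>lin_comb\<close>.\<close>

lemma lin_indep_maps_insert:
  assumes "lin_indep_maps B" "\<not> in_span_maps B M"
  shows "lin_indep_maps (insert M B)"
  unfolding lin_indep_maps_def
proof (intro allI impI, elim conjE)
  fix S a assume S: "finite S" "S \<subseteq> insert M B"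
    and z: "\<forall>f. smooth_vec f \<longrightarrow> lin_comb S a f = (\<lambda>x. 0)"
  have indep: "\<forall>N\<in>T. a N = 0"
    if "finite T" "T \<subseteq> B" "\<forall>f. smooth_vec f \<longrightarrow> lin_comb T a f = (\<lambda>x. 0)" for T
    using assms(1) that unfolding lin_indep_maps_def by blast
  show "\<forall>N\<in>S. a N = 0"
  proof (cases "M \<in> S")
    case False
    then show ?thesis using indep[of S] S z by blast
  next
    case True
    have split: "lin_comb S a f x = a M *\<^sub>R M f x + lin_comb (S - {M}) a f x" for f x
      unfolding lin_comb_def using sum.remove[OF S(1) True] by simp
    have "a M = 0"
    proof (rule ccontr)
      assume nz: "a M \<noteq> 0"
      have "M f = lin_comb (S - {M}) (\<lambda>N. - a N / a M) f" if "smooth_vec f" for f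
      proof
        fix x
        have "a M *\<^sub>R M f x = - lin_comb (S - {M}) a f x"
          using split[of f x] z that by (simp add: eq_neg_iff_add_eq_0)
        then have "inverse (a M) *\<^sub>R (a M *\<^sub>R M f x) = inverse (a M) *\<^sub>R (- lin_comb (S - {M}) a f x)"
          by simp
        then have "M f x = inverse (a M) *\<^sub>R (- lin_comb (S - {M}) a f x)"
          using nz by simp
        also have "\<dots> = lin_comb (S - {M}) (\<lambda>N. - a N / a M) f x"
          by (simp add: lin_comb_def scaleR_right.sum sum_negf divide_inverse mult.commute)
        finally show "M f x = lin_comb (S - {M}) (\<lambda>N. - a N / a M) f x" .
      qed
      then have "in_span_maps B M"
        unfolding in_span_maps_def using S
        by (intro exI[of _ "S - {M}"] exI[of _ "\<lambda>N. - a N / a M"]) auto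
      with assms(2) show False ..
    qed
    moreover have "lin_comb (S - {M}) a f = (\<lambda>x. 0)" if "smooth_vec f" for f
      using split[of f] z that \<open>a M = 0\<close> by (auto simp: fun_eq_iff)
    then have "\<forall>N\<in>S - {M}. a N = 0"
      using indep[of "S - {M}"] S by blast
    ultimately show ?thesis by blast
  qed
qed

text \<open>Greedy selection: run through \<open>A\<close> and keep a map only if it lies outside
  the span of those kept before.\<close>

lemma exists_lin_indep_spanning_subset:
  assumes "finite A"
  shows "\<exists>B\<subseteq>A. lin_indep_maps B \<and> (\<forall>M\<in>A. in_span_maps B M)"
  using assms
proof (induction A rule: finite_induct)
  case empty
  then show ?case by (auto simp: lin_indep_maps_def)
next
  case (insert M A)
  then obtain B where B: "B \<subseteq> A" "lin_indep_maps B" "\<forall>N\<in>A. in_span_maps B N" by blast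
  show ?case
  proof (cases "in_span_maps B M")
    case True
    then show ?thesis using B by blast
  next
    case False
    then have "lin_indep_maps (insert M B)" using B(2) lin_indep_maps_insert by blast
    moreover have "\<forall>N\<in>insert M A. in_span_maps (insert M B) N"
      using B(3) in_span_maps_mono in_span_maps_base by blast
    ultimately show ?thesis using B(1) by (intro exI[of _ "insert M B"]) auto
  qed
qed

section \<open>Tree maps and a basis of \<open>W n\<close> among them\<close>

definition tree_map :: "nat \<Rightarrow> (nat \<times> nat) set \<Rightarrow> ('d::finite) cmap" where
  "tree_map n E = (\<lambda>f. elem_diff n E (\<lambda>_. f))"

lemma finite_RT: "finite (RT n)"
  by (rule finite_subset[of _ "Pow ({1..n} \<times> {1..n})"]) (auto simp: RT_def)

lemma tree_map_in_W:
  assumes "E \<in> RT n"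
  shows "tree_map n E \<in> W n"
proof -
  have "(\<Sum>\<tau>\<in>RT n. (if \<tau> = E then 1 else 0) *\<^sub>R elem_diff n \<tau> (\<lambda>_. f) x) = tree_map n E f x"
    for f :: "real^'a \<Rightarrow> real^'a" and x
    using assms finite_RT[of n] by (simp add: tree_map_def if_distrib[of "\<lambda>c. c *\<^sub>R _"] cong: if_cong)
  then show ?thesis
    unfolding W_def by (auto intro!: exI[of _ "\<lambda>\<tau>. if \<tau> = E then 1 else 0"])
qed

text \<open>The basis is chosen among the tree maps themselves, because the projection of a single
  tree map is a single monomial; a general element of \<open>W n\<close> would only give a
  combination.\<close>

lemma exists_tree_map_basis:
  obtains B :: "('d::finite) cmap set"
  where "B \<subseteq> tree_map n ` RT n" "is_basis_of_W n B"
proof -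
  have "finite (tree_map n ` RT n :: 'd cmap set)" using finite_RT by blast
  from exists_lin_indep_spanning_subset[OF this]
  obtain B :: "'d cmap set" where B: "B \<subseteq> tree_map n ` RT n" "lin_indep_maps B"
    "\<forall>M\<in>tree_map n ` RT n. in_span_maps B M" by blast
  have finB: "finite B" using B(1) finite_RT finite_subset by blast
  have "\<exists>a. \<forall>f. smooth_vec f \<longrightarrow> (tree_map n \<tau> :: 'd cmap) f = lin_comb B a f" if "\<tau> \<in> RT n" for \<tau>
  proof -
    have "in_span_maps B (tree_map n \<tau>)" using B(3) that by blast
    then show ?thesis using finB by (elim in_span_maps_finiteE) auto
  qed
  then obtain a where a: "\<And>\<tau> f. \<tau> \<in> RT n \<Longrightarrow> smooth_vec f \<Longrightarrow>
      (tree_map n \<tau> :: 'd cmap) f = lin_comb B (a \<tau>) f" by metis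
  have "in_span_maps B M" if M: "M \<in> W n" for M
  proof -
    obtain c where c: "\<forall>f. smooth_vec f \<longrightarrow>
        M f = (\<lambda>x. \<Sum>\<tau>\<in>RT n. c \<tau> *\<^sub>R elem_diff n \<tau> (\<lambda>_. f) x)"
      using M unfolding W_def by blast
    \<comment> \<open>Each tree map is expanded in \<open>B\<close> with coefficients
      \<open>a \<tau>\<close>; collecting the coefficient of \<open>N\<close> over all trees gives
      the witness.\<close>
    have "M f = lin_comb B (\<lambda>N. \<Sum>\<tau>\<in>RT n. c \<tau> * a \<tau> N) f" if "smooth_vec f" for f
    proof
      fix x
      have "M f x = (\<Sum>\<tau>\<in>RT n. c \<tau> *\<^sub>R tree_map n \<tau> f x)"
        using c that by (simp add: tree_map_def)
      also have "\<dots> = (\<Sum>\<tau>\<in>RT n. \<Sum>N\<in>B. (c \<tau> * a \<tau> N) *\<^sub>R N f x)"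
        using a that by (intro sum.cong) (auto simp: lin_comb_def scaleR_right.sum)
      also have "\<dots> = (\<Sum>N\<in>B. \<Sum>\<tau>\<in>RT n. (c \<tau> * a \<tau> N) *\<^sub>R N f x)"
        by (rule sum.swap)
      also have "\<dots> = lin_comb B (\<lambda>N. \<Sum>\<tau>\<in>RT n. c \<tau> * a \<tau> N) f x"
        by (simp add: lin_comb_def scaleR_left.sum)
      finally show "M f x = lin_comb B (\<lambda>N. \<Sum>\<tau>\<in>RT n. c \<tau> * a \<tau> N) f x" .
    qed
    then show ?thesis unfolding in_span_maps_def using finB by blast
  qed
  moreover have "B \<subseteq> W n" using B(1) tree_map_in_W by blast
  ultimately show ?thesis using that B unfolding is_basis_of_W_def by blast
qed

section \<open>Combinatorics of rooted trees\<close>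

lemma
  assumes "E \<in> RT n"
  shows tree_root_in: "tree_root n E \<in> {1..n}"
    and tree_root_no_parent: "(v, tree_root n E) \<notin> E"
    and tree_root_unique: "r \<in> {1..n} \<Longrightarrow> \<forall>v. (v, r) \<notin> E \<Longrightarrow> r = tree_root n E"
    and RT_reachable: "w \<in> {1..n} \<Longrightarrow> (tree_root n E, w) \<in> E\<^sup>*"
    and RT_subset: "E \<subseteq> {1..n} \<times> {1..n}"
    and RT_parent_unique: "(u, w) \<in> E \<Longrightarrow> (v, w) \<in> E \<Longrightarrow> u = v"
proof -
  have ex1: "\<exists>!r. r \<in> {1..n} \<and> (\<forall>v. (v, r) \<notin> E)" and sub: "E \<subseteq> {1..n} \<times> {1..n}"
    and par: "\<forall>w\<in>{1..n}. (\<exists>v. (v, w) \<in> E) \<longrightarrow> (\<exists>!v. (v, w) \<in> E)"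
    and reach: "\<forall>r\<in>{1..n}. (\<forall>v. (v, r) \<notin> E) \<longrightarrow> (\<forall>w\<in>{1..n}. (r, w) \<in> E\<^sup>*)"
    using assms unfolding RT_def by blast+
  have root: "tree_root n E \<in> {1..n} \<and> (\<forall>v. (v, tree_root n E) \<notin> E)"
    unfolding tree_root_def by (rule theI'[OF ex1])
  show "tree_root n E \<in> {1..n}" "(v, tree_root n E) \<notin> E" using root by blast+
  show "r = tree_root n E" if "r \<in> {1..n}" "\<forall>v. (v, r) \<notin> E" using ex1 root that by blast
  show "(tree_root n E, w) \<in> E\<^sup>*" if "w \<in> {1..n}" using reach root that by blast
  show "E \<subseteq> {1..n} \<times> {1..n}" by (rule sub)
  show "u = v" if "(u, w) \<in> E" "(v, w) \<in> E" using par sub that by blast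
qed

lemma finite_children: "E \<in> RT n \<Longrightarrow> finite (children E v)"
  by (rule finite_subset[of _ "{1..n}"]) (use RT_subset in \<open>auto simp: children_def\<close>)

text \<open>Induction along the path from the root: nothing enters the root, and a cycle through
  \<open>z\<close> must pass through the only parent \<open>y\<close> of \<open>z\<close>, hence is
  also a cycle through \<open>y\<close>.\<close>

lemma RT_acyclic:
  assumes E: "E \<in> RT n"
  shows "(w, w) \<notin> E\<^sup>+"
proof
  assume cyc: "(w, w) \<in> E\<^sup>+"
  then obtain p where "(p, w) \<in> E" by (meson tranclD2)
  then have "(tree_root n E, w) \<in> E\<^sup>*" using RT_subset[OF E] RT_reachable[OF E] by blast
  then have "(w, w) \<notin> E\<^sup>+"
  proof (induction rule: rtrancl_induct)
    case base
    then show ?case using tree_root_no_parent[OF E] by (meson tranclD2)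
  next
    case (step y z)
    show ?case
    proof
      assume "(z, z) \<in> E\<^sup>+"
      then obtain p where "(z, p) \<in> E\<^sup>*" "(p, z) \<in> E" by (meson tranclD2)
      with step RT_parent_unique[OF E] have "(y, y) \<in> E\<^sup>+"
        by (metis rtrancl_into_trancl2)
      with step.IH show False ..
    qed
  qed
  with cyc show False by blast
qed

text \<open>Parents are unique, so walking upwards from \<open>x\<close> meets all its ancestors on
  one chain.\<close>

lemma RT_ancestors_chain:
  assumes E: "E \<in> RT n" and "(u, x) \<in> E\<^sup>*" "(v, x) \<in> E\<^sup>*"
  shows "(u, v) \<in> E\<^sup>* \<or> (v, u) \<in> E\<^sup>*"
  using assms(2,3)
proof (induction rule: rtrancl_induct)
  case base
  then show ?case by blast
next
  case (step y z)
  note IH = step.IH and yz = step.hyps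
  from step.prems show ?case
  proof (cases rule: rtranclE)
    case base
    then show ?thesis using yz by auto
  next
    case (step y')
    then have "y' = y" using RT_parent_unique[OF E] yz(2) by blast
    with step(1) IH show ?thesis by blast
  qed
qed

lemma descendants_rec: "E\<^sup>* `` {v} = insert v (\<Union>w\<in>children E v. E\<^sup>* `` {w})"
proof -
  have "(v, x) \<in> E\<^sup>* \<longleftrightarrow> x = v \<or> (\<exists>w. (v, w) \<in> E \<and> (w, x) \<in> E\<^sup>*)" for x
    by (auto elim: converse_rtranclE intro: converse_rtrancl_into_rtrancl)
  then show ?thesis by (auto simp: children_def)
qed

lemma descendants_subset:
  assumes "E \<in> RT n" "v \<in> {1..n}"
  shows "E\<^sup>* `` {v} \<subseteq> {1..n}"
proof
  fix x assume "x \<in> E\<^sup>* `` {v}"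
  then have "(v, x) \<in> E\<^sup>*" by simp
  then show "x \<in> {1..n}"
    by (cases rule: rtranclE) (use assms RT_subset[OF assms(1)] in auto)
qed

text \<open>A common descendant would make one sibling an ancestor of the other. The last edge of
  that path starts at the common parent \<open>v\<close>, so \<open>v\<close> would lie below its
  own child, contradicting acyclicity.\<close>

lemma descendants_children_disjoint:
  assumes E: "E \<in> RT n" and w: "w \<in> children E v" "w' \<in> children E v" "w \<noteq> w'"
  shows "E\<^sup>* `` {w} \<inter> E\<^sup>* `` {w'} = {}"
proof -
  have no: "(u, u') \<notin> E\<^sup>*" if vu: "(v, u) \<in> E" "(v, u') \<in> E" and neq: "u \<noteq> u'" for u u'
  proof
    assume "(u, u') \<in> E\<^sup>*"
    then obtain p where "(u, p) \<in> E\<^sup>*" "(p, u') \<in> E"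
      using neq by (meson rtranclE)
    then have "(v, v) \<in> E\<^sup>+"
      using vu RT_parent_unique[OF E] by (metis rtrancl_into_trancl2)
    with RT_acyclic[OF E] show False by blast
  qed
  show ?thesis
    using RT_ancestors_chain[OF E] no w unfolding children_def by blast
qed

lemma not_descendant_of_child:
  assumes E: "E \<in> RT n" and "w \<in> children E v"
  shows "v \<notin> E\<^sup>* `` {w}"
  using assms(2) RT_acyclic[OF E, of v] rtrancl_into_trancl2[of v w E v]
  by (auto simp: children_def)

text \<open>\<open>restrict\<close> makes the function extensional, as membership in
  \<open>MI n\<close> demands.\<close>

definition fertility :: "nat \<Rightarrow> (nat \<times> nat) set \<Rightarrow> nat \<Rightarrow> nat" where
  "fertility n E = restrict (\<lambda>v. card (children E v)) {1..n}"

text \<open>The sets of children are disjoint and together contain every vertex except the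
  root.\<close>

lemma fertility_in_MI:
  assumes E: "E \<in> RT n"
  shows "fertility n E \<in> MI n"
proof -
  have "(\<Sum>v\<in>{1..n}. fertility n E v) = (\<Sum>v\<in>{1..n}. card (children E v))"
    by (simp add: fertility_def)
  also have "\<dots> = card (\<Union>v\<in>{1..n}. children E v)"
    using finite_children[OF E] RT_parent_unique[OF E]
    by (subst card_UN_disjoint) (auto simp: children_def)
  also have "(\<Union>v\<in>{1..n}. children E v) = {1..n} - {tree_root n E}"
    using RT_subset[OF E] tree_root_unique[OF E] tree_root_no_parent[OF E]
    unfolding children_def by blast
  also have "card \<dots> = n - 1" using tree_root_in[OF E] by simp
  finally show ?thesis by (auto simp: MI_def fertility_def)
qed

text \<open>If the fertilities are nonincreasing, the children can be handed out in breadth-first order: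
  vertex \<open>v\<close> receives the next \<open>\<phi> v\<close> unused labels, and monotonicity keeps parents below children.\<close>

lemma exists_tree_of_antimono_fertility:
  assumes n: "n \<ge> 1" and \<phi>: "\<phi> \<in> MI n"
    and anti: "\<And>u v. 1 \<le> u \<Longrightarrow> u \<le> v \<Longrightarrow> v \<le> n \<Longrightarrow> \<phi> v \<le> \<phi> u"
  obtains E where "E \<in> RT n" "fertility n E = \<phi>"
proof -
  \<comment> \<open>\<open>S v\<close> counts the labels handed out to the vertices up to
    \<open>v\<close>. Label 1 is reserved for the root, whence the shift by 1 in
    \<open>E\<close>.\<close>
  define S where "S v = (\<Sum>u\<in>{1..v}. \<phi> u)" for v
  define E where "E = {(v, w). v \<in> {1..n} \<and> S (v - 1) + 1 < w \<and> w \<le> S v + 1}"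
  have Sn: "S n = n - 1" using \<phi> by (auto simp: S_def MI_def)
  have S0: "S 0 = 0" by (simp add: S_def)
  have SSuc: "S (Suc v) = S v + \<phi> (Suc v)" for v by (simp add: S_def)
  have Smono: "S u \<le> S v" if "u \<le> v" for u v
    using that by (auto simp: S_def intro!: sum_mono2)
  \<comment> \<open>Monotonicity enters here: if \<open>\<phi> v\<close> is positive, so are all
    earlier values; if it is zero, so are all later ones, and \<open>S v\<close> has already reached
    \<open>n - 1\<close>.\<close>
  have Sge: "v \<le> S v" if v: "v < n" for v
  proof (cases "v = 0 \<or> 1 \<le> \<phi> v")
    case True
    have "1 \<le> \<phi> u" if "u \<in> {1..v}" for u using True anti[of u v] that v by auto
    then have "(\<Sum>u\<in>{1..v}. 1) \<le> S v" unfolding S_def by (rule sum_mono)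
    then show ?thesis by simp
  next
    case False
    then have "\<phi> u = 0" if "u \<in> {v<..n}" for u using anti[of v u] that by auto
    then have "S n = S v"
      unfolding S_def using v by (intro sum.mono_neutral_right) auto
    then show ?thesis using Sn v by simp
  qed
  have sub: "E \<subseteq> {1..n} \<times> {1..n}"
    using Smono[of _ n] Sn n unfolding E_def by force
  have less: "v < w" if "(v, w) \<in> E" for v w
  proof -
    have "v - 1 < n" "S (v - 1) + 1 < w" using that by (auto simp: E_def)
    then show ?thesis using Sge[of "v - 1"] by linarith
  qed
  have uniq: "u = v" if "(u, w) \<in> E" "(v, w) \<in> E" for u v w
  proof (rule ccontr)
    assume "u \<noteq> v"
    \<comment> \<open>The label intervals of distinct vertices do not overlap, since
      \<open>S\<close> is monotone.\<close>
    moreover have "\<not> a < b" if "(a, w) \<in> E" "(b, w) \<in> E" for a b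
      using Smono[of a "b - 1"] that unfolding E_def by fastforce
    ultimately show False using that by (meson nat_neq_iff)
  qed
  have parent: "\<exists>v. (v, w) \<in> E" if w: "w \<in> {2..n}" for w
  proof -
    \<comment> \<open>The parent of \<open>w\<close> is the first vertex at which the labels handed
      out reach \<open>w\<close>.\<close>
    define v where "v = (LEAST v. w \<le> S v + 1)"
    have ex: "w \<le> S n + 1" using Sn w by simp
    have v: "w \<le> S v + 1" "v \<le> n"
      unfolding v_def using LeastI[of "\<lambda>v. w \<le> S v + 1", OF ex] Least_le[of "\<lambda>v. w \<le> S v + 1", OF ex]
      by auto
    have "v \<noteq> 0" using v(1) S0 w by (intro notI) auto
    then have "\<not> w \<le> S (v - 1) + 1"
      unfolding v_def by (intro not_less_Least) simp
    then have "(v, w) \<in> E" using v \<open>v \<noteq> 0\<close> by (auto simp: E_def)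
    then show ?thesis ..
  qed
  have no1: "(v, 1) \<notin> E" for v using less[of v 1] sub by force
  have reach: "(1, w) \<in> E\<^sup>*" if "w \<in> {1..n}" for w
    using that
  proof (induction w rule: less_induct)
    case (less w)
    show ?case
    proof (cases "w = 1")
      case False
      then obtain v where "(v, w) \<in> E" using parent[of w] less.prems by auto
      moreover from this have "(1, v) \<in> E\<^sup>*"
        using less.IH[of v] \<open>\<And>v w. (v, w) \<in> E \<Longrightarrow> v < w\<close> sub by blast
      ultimately show ?thesis by (meson rtrancl.rtrancl_into_rtrancl)
    qed simp
  qed
  have root: "r = 1" if "r \<in> {1..n}" "\<forall>v. (v, r) \<notin> E" for r
    using parent[of r] that by (cases "r = 1") auto
  have "E \<in> RT n"
    unfolding RT_def
  proof (intro CollectI conjI)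
    show "\<exists>!r. r \<in> {1..n} \<and> (\<forall>v. (v, r) \<notin> E)"
      using no1 root n by (intro ex1I[of _ 1]) auto
    show "\<forall>w\<in>{1..n}. (\<exists>v. (v, w) \<in> E) \<longrightarrow> (\<exists>!v. (v, w) \<in> E)" using uniq by blast
    show "\<forall>r\<in>{1..n}. (\<forall>v. (v, r) \<notin> E) \<longrightarrow> (\<forall>w\<in>{1..n}. (r, w) \<in> E\<^sup>*)"
      using root reach by blast
  qed (rule sub)
  moreover have "fertility n E v = \<phi> v" for v
  proof (cases "v \<in> {1..n}")
    case True
    then have "children E v = {S (v - 1) + 1<..S v + 1}" by (auto simp: children_def E_def)
    then show ?thesis using True SSuc[of "v - 1"] by (simp add: fertility_def)
  next
    case False
    then show ?thesis using \<phi> by (auto simp: fertility_def MI_def PiE_def extensional_def)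
  qed
  ultimately show ?thesis using that by blast
qed

text \<open>Sorting keeps the multiset of values, and two functions with equal value multisets
  differ by a permutation. List positions start at 0 and vertices at 1, hence
  \<open>v - 1\<close>.\<close>

lemma exists_antimono_rearrangement:
  fixes \<phi> :: "nat \<Rightarrow> nat"
  obtains \<sigma> where "\<sigma> permutes {1..n}"
    "\<And>u v. 1 \<le> u \<Longrightarrow> u \<le> v \<Longrightarrow> v \<le> n \<Longrightarrow> \<phi> (\<sigma> v) \<le> \<phi> (\<sigma> u)"
proof -
  define ys where "ys = rev (sort (map \<phi> [1..<Suc n]))"
  have len: "length ys = n" by (simp add: ys_def)
  have desc: "ys ! j \<le> ys ! i" if "i \<le> j" "j < n" for i j
    using that sorted_rev_nth_mono[of ys i j] len by (simp add: ys_def)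
  have "image_mset (\<lambda>v. ys ! (v - 1)) (mset_set {1..n}) = mset (map (\<lambda>v. ys ! (v - 1)) [1..<Suc n])"
    unfolding mset_map mset_upt atLeastLessThanSuc_atLeastAtMost ..
  also have "map (\<lambda>v. ys ! (v - 1)) [1..<Suc n] = ys"
    by (rule nth_equalityI) (auto simp: len simp del: upt_Suc)
  also have "mset ys = image_mset \<phi> (mset_set {1..n})"
    unfolding ys_def mset_rev mset_sort mset_map mset_upt atLeastLessThanSuc_atLeastAtMost ..
  finally obtain \<sigma> where \<sigma>: "\<sigma> permutes {1..n}" "\<forall>v\<in>{1..n}. ys ! (v - 1) = \<phi> (\<sigma> v)"
    using image_mset_eq_implies_permutes[of "{1..n}" "\<lambda>v. ys ! (v - 1)" \<phi>] by auto
  show ?thesis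
  proof (rule that[OF \<sigma>(1)])
    fix u v assume "1 \<le> u" "u \<le> v" "v \<le> n"
    then show "\<phi> (\<sigma> v) \<le> \<phi> (\<sigma> u)" using \<sigma>(2) desc[of "u - 1" "v - 1"] by auto
  qed
qed

section \<open>Orbits of \<open>MI n\<close> and evaluation of \<open>G\<close> on them\<close>

lemma MI_comp_permutes:
  assumes "\<phi> \<in> MI n" "\<sigma> permutes {1..n}"
  shows "\<phi> \<circ> \<sigma> \<in> MI n"
proof -
  have "(\<Sum>v\<in>{1..n}. (\<phi> \<circ> \<sigma>) v) = (\<Sum>v\<in>{1..n}. \<phi> v)"
    using sum.permute[OF assms(2), of \<phi>] by simp
  moreover have "\<phi> \<circ> \<sigma> \<in> {1..n} \<rightarrow>\<^sub>E UNIV"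
    using assms permutes_not_in[OF assms(2)]
    by (auto simp: MI_def PiE_def extensional_def)
  ultimately show ?thesis using assms(1) by (simp add: MI_def)
qed

lemma equiv_MI_rel: "equiv (MI n) (MI_rel n)"
proof (rule equivI)
  show "MI_rel n \<subseteq> MI n \<times> MI n" by (auto simp: MI_rel_def)
  show "refl_on (MI n) (MI_rel n)"
    using permutes_id[of "{1..n}"] by (auto simp: refl_on_def MI_rel_def intro!: exI[of _ id])
  show "sym (MI_rel n)"
  proof (rule symI)
    fix \<phi> \<psi> assume "(\<phi>, \<psi>) \<in> MI_rel n"
    then obtain \<sigma> where "\<phi> \<in> MI n" "\<psi> \<in> MI n" "\<sigma> permutes {1..n}" "\<psi> = \<phi> \<circ> \<sigma>"
      by (auto simp: MI_rel_def)
    then show "(\<psi>, \<phi>) \<in> MI_rel n"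
      using permutes_inv[of \<sigma>] permutes_inv_o(1)[of \<sigma>]
      by (auto simp: MI_rel_def comp_assoc intro!: exI[of _ "inv \<sigma>"])
  qed
  show "trans (MI_rel n)"
  proof (rule transI)
    fix \<phi> \<psi> \<theta> assume "(\<phi>, \<psi>) \<in> MI_rel n" "(\<psi>, \<theta>) \<in> MI_rel n"
    then obtain \<sigma> \<rho> where "\<phi> \<in> MI n" "\<theta> \<in> MI n" "\<sigma> permutes {1..n}" "\<rho> permutes {1..n}"
      "\<theta> = \<phi> \<circ> (\<sigma> \<circ> \<rho>)"
      by (auto simp: MI_rel_def comp_assoc)
    moreover from this have "\<sigma> \<circ> \<rho> permutes {1..n}" by (blast intro: permutes_compose)
    ultimately show "(\<phi>, \<theta>) \<in> MI_rel n" unfolding MI_rel_def by blast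
  qed
qed

text \<open>Each orbit contains a nonincreasing representative, to which the breadth-first
  construction applies.\<close>

lemma exists_tree_of_class:
  assumes "n \<ge> 1" "c \<in> MIS n"
  obtains E where "E \<in> RT n" "c = MI_rel n `` {fertility n E}"
proof -
  obtain \<phi> where \<phi>: "\<phi> \<in> MI n" "c = MI_rel n `` {\<phi>}"
    using assms(2) by (auto simp: MIS_def quotient_def)
  obtain \<sigma> where \<sigma>: "\<sigma> permutes {1..n}"
    "\<And>u v. 1 \<le> u \<Longrightarrow> u \<le> v \<Longrightarrow> v \<le> n \<Longrightarrow> \<phi> (\<sigma> v) \<le> \<phi> (\<sigma> u)"
    using exists_antimono_rearrangement by blast
  have mem: "\<phi> \<circ> \<sigma> \<in> MI n" using MI_comp_permutes \<phi> \<sigma> by blast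
  then obtain E where E: "E \<in> RT n" "fertility n E = \<phi> \<circ> \<sigma>"
    using exists_tree_of_antimono_fertility[of n "\<phi> \<circ> \<sigma>"] assms(1) \<sigma>(2) by auto
  have "(\<phi>, \<phi> \<circ> \<sigma>) \<in> MI_rel n" using mem \<phi> \<sigma> by (auto simp: MI_rel_def)
  then show ?thesis using that E \<phi>(2) equiv_class_eq[OF equiv_MI_rel] by metis
qed

text \<open>\<open>G\<close> evaluates at a chosen representative; any other one merely reorders the
  factors.\<close>

lemma G_class:
  assumes "\<phi> \<in> MI n"
  shows "G n (MI_rel n `` {\<phi>}) g t = (\<Prod>v\<in>{1..n}. (deriv ^^ \<phi> v) g t)"
proof -
  define \<psi> where "\<psi> = (SOME \<psi>. \<psi> \<in> MI_rel n `` {\<phi>})"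
  have "\<phi> \<in> MI_rel n `` {\<phi>}" using equiv_class_self[OF equiv_MI_rel assms] .
  then have "\<psi> \<in> MI_rel n `` {\<phi>}" unfolding \<psi>_def by (rule someI[of "\<lambda>\<psi>. \<psi> \<in> MI_rel n `` {\<phi>}"])
  then obtain \<sigma> where \<sigma>: "\<sigma> permutes {1..n}" "\<psi> = \<phi> \<circ> \<sigma>" by (auto simp: MI_rel_def)
  have "G n (MI_rel n `` {\<phi>}) g t = (\<Prod>v\<in>{1..n}. (deriv ^^ \<phi> (\<sigma> v)) g t)"
    unfolding G_def \<psi>_def[symmetric] Let_def \<sigma>(2) o_def ..
  also have "\<dots> = (\<Prod>v\<in>{1..n}. (deriv ^^ \<phi> v) g t)"
    using prod.permute[OF \<sigma>(1), of "\<lambda>v. (deriv ^^ \<phi> v) g t"] by (simp add: o_def)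
  finally show ?thesis .
qed

section \<open>Projection of elementary differentials\<close>

text \<open>This is the vector field that \<open>proj\<close> feeds into a map.\<close>

definition lift1 :: "(real \<Rightarrow> real) \<Rightarrow> real^('d::{finite,wellorder}) \<Rightarrow> real^('d::{finite,wellorder})" where
  "lift1 g = (\<lambda>x. \<chi> i. if i = e1 then g (x $ e1) else 0)"

lemma rpartials_zero: "rpartials js (\<lambda>x. 0) = (\<lambda>x. 0)"
  by (induction js) (auto simp: partial_def fun_eq_iff)

text \<open>Both derivative predicates agree for every candidate value, so \<open>deriv\<close>
  picks the same number on both sides even where \<open>h\<close> is not differentiable.\<close>

lemma deriv_shift: "deriv (\<lambda>t. h (a + t)) 0 = deriv h (a::real)"
proof -
  have "((\<lambda>t. h (a + t)) has_field_derivative D) (at 0) \<longleftrightarrow> (h has_field_derivative D) (at a)" for D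
    using DERIV_shift[of h D 0 a] by (simp add: add.commute)
  then show ?thesis by (simp add: deriv_def)
qed

lemma partial_coordinate:
  "partial j (\<lambda>x. h (x $ i)) = (if j = i then (\<lambda>x. deriv h (x $ i)) else (\<lambda>x. 0))"
  by (auto simp: partial_def fun_eq_iff axis_def deriv_shift)

text \<open>A derivative in any direction other than \<open>i\<close> annihilates a function of the
  coordinate \<open>i\<close> alone.\<close>

lemma rpartials_coordinate:
  "rpartials js (\<lambda>x. g (x $ i)) =
    (if set js \<subseteq> {i} then (\<lambda>x. (deriv ^^ length js) g (x $ i)) else (\<lambda>x. 0))"
proof (induction js)
  case (Cons j js)
  then show ?case
    using partial_coordinate[of j "(deriv ^^ length js) g" i] rpartials_zero[of "[j]"]
    by auto
qed simp

lemma lift1_nth: "(\<lambda>y. lift1 g y $ i) = (if i = e1 then (\<lambda>y. g (y $ e1)) else (\<lambda>y. 0))"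
  by (auto simp: lift1_def)

lemma dpartials_lift1:
  "dpartials js (lift1 g) x $ i =
    (if i = e1 \<and> set js \<subseteq> {e1} then (deriv ^^ length js) g (x $ e1) else 0)"
  by (auto simp: dpartials_def lift1_nth rpartials_zero rpartials_coordinate)

text \<open>Relations between maps hold on smooth fields only; this allows them to be applied to
  lifted functions.\<close>

lemma smooth_vec_lift1:
  assumes "smooth1 g"
  shows "smooth_vec (lift1 g :: real^('d::{finite,wellorder}) \<Rightarrow> real^('d::{finite,wellorder}))"
proof -
  have dif: "(deriv ^^ k) g differentiable (at t)" for k t
    using assms by (simp add: smooth1_def)
  have "continuous_on UNIV ((deriv ^^ k) g)" for k
    using dif by (meson continuous_at_imp_continuous_on differentiable_imp_continuous_within)
  then have cont: "continuous_on UNIV (\<lambda>x :: (real,'d) vec. (deriv ^^ k) g (x $ e1))" for k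
    by (rule continuous_on_compose2) (auto intro!: continuous_intros)
  have "(\<lambda>t. (deriv ^^ k) g (c + t * b)) differentiable (at 0)" for k c b
  proof -
    have "((deriv ^^ k) g \<circ> (\<lambda>t. c + t * b)) differentiable (at 0)"
      by (rule differentiable_chain_at[OF _ dif]) auto
    then show ?thesis by (simp add: o_def)
  qed
  then have "smooth_real (\<lambda>x :: (real,'d) vec. g (x $ e1))"
    unfolding smooth_real_def rpartials_coordinate using cont by auto
  moreover have "smooth_real (\<lambda>x :: (real,'d) vec. 0)"
    unfolding smooth_real_def rpartials_zero by auto
  ultimately show ?thesis unfolding smooth_vec_def lift1_nth by auto
qed

text \<open>In the sum over index assignments only the constant assignment \<open>e1\<close>
  survives, because every other one differentiates in a direction on which the lifted field does not
  depend.\<close>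

lemma elem_diff_at_lift1_Suc:
  fixes x :: "real^'d::{finite,wellorder}"
  assumes fin: "finite (children E v)"
  shows "elem_diff_at (Suc k) E (\<lambda>_. lift1 g) v x $ e1 =
    (deriv ^^ card (children E v)) g (x $ e1) *
    (\<Prod>w\<in>children E v. elem_diff_at k E (\<lambda>_. lift1 g) w x $ e1)"
proof -
  let ?C = "children E v" and ?J = "restrict (\<lambda>_. e1) (children E v) :: nat \<Rightarrow> 'd"
  let ?t = "\<lambda>J. (\<Prod>w\<in>?C. elem_diff_at k E (\<lambda>_. lift1 g) w x $ J w) *
      (dpartials (map J (sorted_list_of_set ?C)) (lift1 g) x $ e1)"
  have "elem_diff_at (Suc k) E (\<lambda>_. lift1 g) v x $ e1 = (\<Sum>J\<in>?C \<rightarrow>\<^sub>E UNIV. ?t J)"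
    by simp
  also have "\<dots> = (\<Sum>J\<in>{?J}. ?t J)"
  proof (rule sum.mono_neutral_right)
    show "finite (?C \<rightarrow>\<^sub>E (UNIV :: 'd set))" using fin by (intro finite_PiE) auto
    show "\<forall>J\<in>(?C \<rightarrow>\<^sub>E UNIV) - {?J}. ?t J = 0"
    proof
      fix J assume J: "J \<in> (?C \<rightarrow>\<^sub>E UNIV) - {?J}"
      have "\<not> J ` ?C \<subseteq> {e1}"
      proof
        assume "J ` ?C \<subseteq> {e1}"
        then have "J = ?J" using J by (intro extensionalityI[of _ ?C]) (auto simp: PiE_def)
        with J show False by simp
      qed
      then show "?t J = 0" using fin by (simp add: dpartials_lift1)
    qed
  qed auto
  also have "\<dots> = (deriv ^^ card ?C) g (x $ e1) *
      (\<Prod>w\<in>?C. elem_diff_at k E (\<lambda>_. lift1 g) w x $ e1)"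
    using fin by (auto simp: dpartials_lift1 intro!: prod.cong)
  finally show ?thesis .
qed

text \<open>The subtrees of the children partition the proper descendants of \<open>v\<close>, so
  the recursive product unfolds into one over all descendants. Fuel bounded below by the subtree
  size suffices, since passing to a child loses at least \<open>v\<close>.\<close>

lemma elem_diff_at_lift1:
  fixes x :: "real^'d::{finite,wellorder}"
  assumes E: "E \<in> RT n" and "v \<in> {1..n}" "card (E\<^sup>* `` {v}) \<le> k"
  shows "elem_diff_at k E (\<lambda>_. lift1 g) v x $ e1 =
    (\<Prod>u\<in>E\<^sup>* `` {v}. (deriv ^^ card (children E u)) g (x $ e1))"
  using assms(2,3)
proof (induction k arbitrary: v)
  case 0
  have "finite (E\<^sup>* `` {v})" using descendants_subset[OF E 0(1)] finite_subset by blast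
  \<comment> \<open>Impossible case: \<open>v\<close> is its own descendant, so the subtree is
    nonempty.\<close>
  with 0 show ?case by auto
next
  case (Suc k)
  let ?C = "children E v" and ?h = "\<lambda>u. (deriv ^^ card (children E u)) g (x $ e1)"
  have C: "?C \<subseteq> {1..n}" using RT_subset[OF E] by (auto simp: children_def)
  have finD: "finite (E\<^sup>* `` {w})" if "w \<in> {1..n}" for w
    using descendants_subset[OF E that] finite_subset by blast
  have IH: "elem_diff_at k E (\<lambda>_. lift1 g) w x $ e1 = prod ?h (E\<^sup>* `` {w})" if w: "w \<in> ?C" for w
  proof (rule Suc.IH)
    have "E\<^sup>* `` {w} \<subset> E\<^sup>* `` {v}"
      using not_descendant_of_child[OF E w] descendants_rec[of E v] w by blast
    then have "card (E\<^sup>* `` {w}) < card (E\<^sup>* `` {v})"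
      by (rule psubset_card_mono[OF finD[OF Suc.prems(1)]])
    then show "card (E\<^sup>* `` {w}) \<le> k" using Suc.prems(2) by simp
  qed (use C w in auto)
  have "prod ?h (E\<^sup>* `` {v}) = ?h v * prod ?h (\<Union>w\<in>?C. E\<^sup>* `` {w})"
    unfolding descendants_rec[of E v] using not_descendant_of_child[OF E] finD C finite_children[OF E]
    by (subst prod.insert) auto
  also have "prod ?h (\<Union>w\<in>?C. E\<^sup>* `` {w}) = (\<Prod>w\<in>?C. prod ?h (E\<^sup>* `` {w}))"
  proof (rule prod.UNION_disjoint)
    show "\<forall>w\<in>?C. finite (E\<^sup>* `` {w})" using finD C by blast
    show "\<forall>w\<in>?C. \<forall>w'\<in>?C. w \<noteq> w' \<longrightarrow> E\<^sup>* `` {w} \<inter> E\<^sup>* `` {w'} = {}"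
      using descendants_children_disjoint[OF E] by blast
  qed (rule finite_children[OF E])
  also have "\<dots> = (\<Prod>w\<in>?C. elem_diff_at k E (\<lambda>_. lift1 g) w x $ e1)"
    using IH by simp
  finally show ?case using elem_diff_at_lift1_Suc[OF finite_children[OF E]] by metis
qed

lemma proj_tree_map:
  assumes E: "E \<in> RT n"
  shows "proj (tree_map n E :: ('d::{finite,wellorder}) cmap) g = G n (MI_rel n `` {fertility n E}) g"
proof
  fix t
  have D: "E\<^sup>* `` {tree_root n E} = {1..n}"
    using descendants_subset[OF E tree_root_in[OF E]] RT_reachable[OF E] by blast
  have "proj (tree_map n E :: 'd cmap) g t =
      elem_diff_at n E (\<lambda>_. lift1 g) (tree_root n E) ((\<chi> i. if i = e1 then t else 0) :: (real,'d) vec) $ e1"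
    by (simp add: proj_def tree_map_def elem_diff_def lift1_def)
  also have "\<dots> = (\<Prod>u\<in>{1..n}. (deriv ^^ card (children E u)) g t)"
    by (subst elem_diff_at_lift1[OF E tree_root_in[OF E]]) (simp_all add: D)
  also have "\<dots> = G n (MI_rel n `` {fertility n E}) g t"
    unfolding G_class[OF fertility_in_MI[OF E]] by (simp add: fertility_def)
  finally show "proj (tree_map n E :: 'd cmap) g t = G n (MI_rel n `` {fertility n E}) g t" .
qed

section \<open>Linear independence of the monomials\<close>

lemma higher_deriv_poly: "(deriv ^^ k) (poly p) = poly ((pderiv ^^ k) p)" for p :: "real poly"
proof (induction k)
  case (Suc k)
  have "deriv (poly q) = poly (pderiv q)" for q :: "real poly"
    by (auto intro!: DERIV_imp_deriv poly_DERIV)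
  with Suc show ?case by simp
qed simp

text \<open>A Taylor polynomial realises any prescribed finite jet at 0.\<close>

lemma exists_smooth1_jet:
  fixes c :: "nat \<Rightarrow> real"
  obtains g where "smooth1 g" "\<And>k. k < N \<Longrightarrow> (deriv ^^ k) g 0 = c k"
proof -
  define p where "p = (\<Sum>k<N. monom (c k / fact k) k)"
  have "smooth1 (poly p)"
    unfolding smooth1_def higher_deriv_poly
    by (meson poly_DERIV real_differentiable_def)
  moreover have "(deriv ^^ k) (poly p) 0 = c k" if "k < N" for k
  proof -
    have "coeff p k = c k / fact k"
      using that by (simp add: p_def coeff_sum)
    then show ?thesis
      by (simp add: higher_deriv_poly poly_0_coeff_0 coeff_higher_pderiv flip: pochhammer_fact)
  qed
  ultimately show ?thesis using that by blast
qed

text \<open>The remainder modulo \<open>B\<close> is the lowest digit, and the quotient carries the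
  remaining ones.\<close>

lemma digits_unique:
  fixes a b :: "nat \<Rightarrow> nat"
  assumes "\<And>k. a k < B" "\<And>k. b k < B" "(\<Sum>k<N. a k * B ^ k) = (\<Sum>k<N. b k * B ^ k)" "k < N"
  shows "a k = b k"
  using assms
proof (induction N arbitrary: a b k)
  case (Suc N)
  have split: "(\<Sum>k<Suc N. d k * B ^ k) = d 0 + B * (\<Sum>k<N. d (Suc k) * B ^ k)" for d :: "nat \<Rightarrow> nat"
    by (subst sum.lessThan_Suc_shift) (simp add: sum_distrib_left mult_ac)
  have eq: "a 0 + B * (\<Sum>k<N. a (Suc k) * B ^ k) = b 0 + B * (\<Sum>k<N. b (Suc k) * B ^ k)"
    using Suc.prems(3) by (simp only: split)
  have lt: "a 0 < B" "b 0 < B" using Suc.prems by auto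
  have "a 0 = b 0" using arg_cong[OF eq, of "\<lambda>x. x mod B"] lt by simp
  moreover have "(\<Sum>k<N. a (Suc k) * B ^ k) = (\<Sum>k<N. b (Suc k) * B ^ k)"
    using arg_cong[OF eq, of "\<lambda>x. x div B"] lt by simp
  then have "a (Suc j) = b (Suc j)" if "j < N" for j
    using Suc.IH[of "\<lambda>k. a (Suc k)" "\<lambda>k. b (Suc k)" j] Suc.prems that by blast
  ultimately show ?case using Suc.prems(4) by (cases k) auto
qed simp

text \<open>The weight of \<open>\<phi>\<close> has the multiplicities of the values of \<open>\<phi>\<close> as its digits in base \<open>n + 1\<close>.\<close>

definition weight :: "nat \<Rightarrow> (nat \<Rightarrow> nat) \<Rightarrow> nat" where
  "weight n \<phi> = (\<Sum>v\<in>{1..n}. (n + 1) ^ \<phi> v)"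

lemma MI_less:
  assumes "\<phi> \<in> MI n" "v \<in> {1..n}"
  shows "\<phi> v < n"
proof -
  have "\<phi> v \<le> (\<Sum>u\<in>{1..n}. \<phi> u)" using assms(2) by (intro member_le_sum) auto
  then show ?thesis using assms by (auto simp: MI_def)
qed

text \<open>Multiplicities are at most \<open>n\<close>, hence valid digits in base
  \<open>n + 1\<close>, and all values are below \<open>n\<close>. Equal weights therefore give
  equal multiplicities, and so a permutation between the two functions.\<close>

lemma weight_inj:
  assumes "\<phi> \<in> MI n" "\<psi> \<in> MI n" "weight n \<phi> = weight n \<psi>"
  shows "(\<phi>, \<psi>) \<in> MI_rel n"
proof -
  define m where "m \<theta> k = card {v \<in> {1..n}. \<theta> v = k}" for \<theta> :: "nat \<Rightarrow> nat" and k
  have less: "m \<theta> k < n + 1" for \<theta> k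
  proof -
    have "m \<theta> k \<le> card {1..n}" unfolding m_def by (rule card_mono) auto
    then show ?thesis by simp
  qed
  have weight: "weight n \<theta> = (\<Sum>k<n. m \<theta> k * (n + 1) ^ k)" if "\<theta> \<in> MI n" for \<theta>
  proof -
    have "weight n \<theta> = (\<Sum>k<n. \<Sum>v\<in>{v \<in> {1..n}. \<theta> v = k}. (n + 1) ^ \<theta> v)"
      unfolding weight_def using MI_less[OF that] by (subst sum.group) auto
    also have "\<dots> = (\<Sum>k<n. m \<theta> k * (n + 1) ^ k)"
      by (intro sum.cong) (auto simp: m_def)
    finally show ?thesis .
  qed
  have "m \<phi> k = m \<psi> k" for k
  proof (cases "k < n")
    case True
    then show ?thesis
      using digits_unique[of "m \<phi>" "n + 1" "m \<psi>" n k] less assms weight by simp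
  next
    case False
    then have "{v \<in> {1..n}. \<phi> v = k} = {}" "{v \<in> {1..n}. \<psi> v = k} = {}"
      using MI_less assms by blast+
    then show ?thesis by (simp only: m_def)
  qed
  moreover have "card {v \<in> {1..n}. k = \<theta> v} = m \<theta> k" for \<theta> k
    unfolding m_def by (intro arg_cong[of _ _ card]) auto
  ultimately have "card {v \<in> {1..n}. k = \<psi> v} = card {v \<in> {1..n}. k = \<phi> v}" for k
    by presburger
  then have "image_mset \<psi> (mset_set {1..n}) = image_mset \<phi> (mset_set {1..n})"
    by (intro multiset_eqI) (simp add: count_image_mset')
  then obtain \<sigma> where \<sigma>: "\<sigma> permutes {1..n}" "\<forall>v\<in>{1..n}. \<psi> v = \<phi> (\<sigma> v)"
    using image_mset_eq_implies_permutes[of "{1..n}" \<psi> \<phi>] by auto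
  have "\<psi> = \<phi> \<circ> \<sigma>"
    using \<sigma> assms MI_comp_permutes[OF assms(1) \<sigma>(1)]
    by (intro extensionalityI[of _ "{1..n}"]) (auto simp: MI_def PiE_def)
  with \<sigma>(1) assms show ?thesis by (auto simp: MI_rel_def)
qed

text \<open>Test functions with suitable jets turn each monomial into a power of \<open>X\<close>
  whose exponent is its weight. The relation becomes a polynomial identity, and weights separate
  orbits.\<close>

lemma monomial_relation_class:
  fixes a :: "'i \<Rightarrow> real"
  assumes "finite S" "\<phi> \<in> MI n" "\<And>i. i \<in> S \<Longrightarrow> \<psi> i \<in> MI n"
    and rel: "\<And>g. smooth1 g \<Longrightarrow>
      G n (MI_rel n `` {\<phi>}) g 0 = (\<Sum>i\<in>S. a i * G n (MI_rel n `` {\<psi> i}) g 0)"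
  obtains i where "i \<in> S" "MI_rel n `` {\<psi> i} = MI_rel n `` {\<phi>}"
proof -
  define p where "p = (\<Sum>i\<in>S. monom (a i) (weight n (\<psi> i)))"
  have "poly (monom 1 (weight n \<phi>)) X = poly p X" for X
  proof -
    \<comment> \<open>With these jets a factor of order \<open>k\<close> contributes the exponent
      \<open>(n + 1) ^ k\<close>, so a product contributes the weight.\<close>
    obtain g where g: "smooth1 g" "\<And>k. k < n \<Longrightarrow> (deriv ^^ k) g 0 = X ^ ((n + 1) ^ k)"
      using exists_smooth1_jet[of n "\<lambda>k. X ^ ((n + 1) ^ k)"] by blast
    have "G n (MI_rel n `` {\<theta>}) g 0 = X ^ weight n \<theta>" if "\<theta> \<in> MI n" for \<theta>
      using that MI_less[OF that] g(2) by (simp add: G_class weight_def power_sum)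
    then show ?thesis
      using rel[OF g(1)] assms(2,3) by (simp add: p_def poly_sum poly_monom)
  qed
  then have "monom 1 (weight n \<phi>) = p" by (simp add: poly_eq_poly_eq_iff[symmetric] fun_eq_iff)
  \<comment> \<open>A coefficient 1 at this weight forces some summand of \<open>p\<close> to have
    the same weight.\<close>
  then have "coeff p (weight n \<phi>) = 1" by (metis coeff_monom)
  then have "(\<Sum>i\<in>S. coeff (monom (a i) (weight n (\<psi> i))) (weight n \<phi>)) \<noteq> 0"
    by (simp add: p_def coeff_sum)
  then obtain i where "i \<in> S" "coeff (monom (a i) (weight n (\<psi> i))) (weight n \<phi>) \<noteq> 0"
    by (rule sum.not_neutral_contains_not_neutral)
  then have i: "i \<in> S" "weight n (\<psi> i) = weight n \<phi>"
    by (auto split: if_splits)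
  then have "(\<psi> i, \<phi>) \<in> MI_rel n" using weight_inj assms by blast
  with i(1) show ?thesis using that equiv_class_eq[OF equiv_MI_rel] by blast
qed

section \<open>Surjectivity onto the orbits and assembly of the description\<close>

text \<open>\<open>T\<close> picks a tree for each basis map. Expanding the map of a tree with class
  \<open>c\<close> in the basis and projecting at the point 0 gives a relation among monomials, in
  which \<open>c\<close> must occur on the right.\<close>

lemma basis_meets_every_class:
  fixes B :: "('d::{finite,wellorder}) cmap set"
  assumes n: "n \<ge> 1" and basis: "is_basis_of_W n B" and "finite B"
    and T: "\<And>M. M \<in> B \<Longrightarrow> T M \<in> RT n \<and> tree_map n (T M) = M" and "c \<in> MIS n"
  shows "\<exists>M\<in>B. MI_rel n `` {fertility n (T M)} = c"
proof -
  obtain E where E: "E \<in> RT n" "c = MI_rel n `` {fertility n E}"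
    using exists_tree_of_class[OF n \<open>c \<in> MIS n\<close>] .
  have "in_span_maps B (tree_map n E)"
    using basis tree_map_in_W[OF E(1)] by (auto simp: is_basis_of_W_def)
  then obtain a where a: "\<And>f. smooth_vec f \<Longrightarrow> tree_map n E f = lin_comb B a f"
    using in_span_maps_finiteE \<open>finite B\<close> by blast
  have proj_M: "proj M g 0 = G n (MI_rel n `` {fertility n (T M)}) g 0" if "M \<in> B" for M g
    using proj_tree_map[of "T M" n g] T[OF that] by metis
  have "G n (MI_rel n `` {fertility n E}) g 0 =
      (\<Sum>M\<in>B. a M * G n (MI_rel n `` {fertility n (T M)}) g 0)" if g: "smooth1 g" for g
  proof -
    let ?o = "(\<chi> i. if i = e1 then 0 else 0) :: (real,'d) vec"
    have proj_eq: "proj M g 0 = M (lift1 g) ?o $ e1" for M :: "'d cmap"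
      by (simp add: proj_def lift1_def)
    have "G n (MI_rel n `` {fertility n E}) g 0 = proj (tree_map n E :: 'd cmap) g 0"
      using proj_tree_map[OF E(1)] by metis
    also have "\<dots> = (\<Sum>M\<in>B. a M * proj M g 0)"
      unfolding proj_eq using a[OF smooth_vec_lift1[OF g]] by (simp add: lin_comb_def)
    also have "\<dots> = (\<Sum>M\<in>B. a M * G n (MI_rel n `` {fertility n (T M)}) g 0)"
      using proj_M by simp
    finally show ?thesis .
  qed
  moreover have "fertility n (T M) \<in> MI n" if "M \<in> B" for M
    using fertility_in_MI T[OF that] by blast
  ultimately obtain M where "M \<in> B" "MI_rel n `` {fertility n (T M)} = MI_rel n `` {fertility n E}"
    using monomial_relation_class[OF \<open>finite B\<close> fertility_in_MI[OF E(1)], of "\<lambda>M. fertility n (T M)" a]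
    by blast
  with E(2) show ?thesis by blast
qed

theorem theorem6p7:
  shows "\<exists>(CD :: nat \<Rightarrow> nat set)
           (H :: nat \<Rightarrow> nat \<Rightarrow> ('d::{finite,wellorder}) cmap)
           (q :: nat \<Rightarrow> nat \<Rightarrow> (nat \<Rightarrow> nat) set).
     \<forall>n\<ge>1. (\<forall>a\<in>CD n. H n a \<in> W n)
          \<and> is_basis_of_W n (H n ` CD n)
          \<and> q n ` CD n = MIS n
          \<and> (\<forall>a\<in>CD n. \<forall>g. smooth1 g \<longrightarrow> proj (H n a) g = G n (q n a) g)"
proof -
  have "\<exists>(C :: nat set) (h :: nat \<Rightarrow> 'd cmap) (r :: nat \<Rightarrow> (nat \<Rightarrow> nat) set).
      (\<forall>a\<in>C. h a \<in> W n) \<and> is_basis_of_W n (h ` C) \<and> r ` C = MIS n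
      \<and> (\<forall>a\<in>C. \<forall>g. smooth1 g \<longrightarrow> proj (h a) g = G n (r a) g)" if n: "n \<ge> 1" for n
  proof -
    obtain B :: "'d cmap set" where B: "B \<subseteq> tree_map n ` RT n" "is_basis_of_W n B"
      by (rule exists_tree_map_basis)
    have finB: "finite B" using B(1) finite_RT finite_subset by blast
    \<comment> \<open>The index sets consist of natural numbers, so the finite basis is
      enumerated.\<close>
    obtain h where h: "h ` {0..<card B} = B"
      using ex_bij_betw_nat_finite[OF finB] by (auto simp: bij_betw_def)
    have "\<forall>M\<in>B. \<exists>E. E \<in> RT n \<and> tree_map n E = M" using B(1) by blast
    \<comment> \<open>Several trees may induce the same map; fixing one for each basis map makes
      \<open>r\<close> well defined.\<close>
    then obtain T where T: "\<And>M. M \<in> B \<Longrightarrow> T M \<in> RT n \<and> tree_map n (T M) = M" by metis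
    define r where "r a = MI_rel n `` {fertility n (T (h a))}" for a
    have hB: "h a \<in> B" if "a \<in> {0..<card B}" for a using h that by blast
    have "r ` {0..<card B} \<subseteq> MIS n"
      using T hB fertility_in_MI by (auto simp: r_def MIS_def intro!: quotientI)
    moreover have "MIS n \<subseteq> r ` {0..<card B}"
    proof
      fix c assume "c \<in> MIS n"
      with basis_meets_every_class[OF n B(2) finB, of T c] T
      obtain M where "M \<in> B" "MI_rel n `` {fertility n (T M)} = c" by blast
      moreover from this have "M \<in> h ` {0..<card B}" by (simp only: h)
      ultimately show "c \<in> r ` {0..<card B}" unfolding r_def by blast
    qed
    moreover have "proj (h a) g = G n (r a) g" if "a \<in> {0..<card B}" for a g
      using proj_tree_map[of "T (h a)" n g] T[OF hB[OF that]] unfolding r_def by metis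
    moreover have "is_basis_of_W n (h ` {0..<card B})" using B(2) by (simp only: h)
    moreover have "h a \<in> W n" if "a \<in> {0..<card B}" for a
      using B(2) hB[OF that] unfolding is_basis_of_W_def by blast
    ultimately show ?thesis
      by (intro exI[of _ "{0..<card B}"] exI[of _ h] exI[of _ r]) simp
  qed
  then show ?thesis by metis
qed

end
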